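(* Let $G$ be a finite simple graph with chromatic number $\chi=\chi(G)\geq 2$. Then for every integer $k\geq 1$, $mc_k(G)=\left\lfloor \frac{k-1}{\chi-1}\right\rfloor$.
   Context: All graphs are simple and finite. For an integer $k\ge 1$, an anti-$k$-labeling of a graph $G$ is an arbitrary map $\psi:V(G)\to\{1,2,\ldots,k\}$. For an edge $e=uv$ put $w_\psi(e)=|\psi(u)-\psi(v)|$, and let $w_\psi(G)=\min\{w_\psi(e): e\in E(G)\}$. The anti-$k$-labeling number of $G$ is $mc_k(G)=\max_\psi w_\psi(G)$, the maximum being over all anti-$k$-labelings $\psi$ of $G$. *)

theory Defs
  imports Complex_Main "HOL-Library.FuncSet" "Graph_Theory.Digraph"
begin

text \<open>
  A finite simple graph is a digraph \<open>G\<close> with \<open>graph G\<close>: finite, loop-free, without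
  parallel arcs, and symmetric. An undirected edge \<open>uv\<close> is the pair of arcs from \<open>u\<close> to \<open>v\<close>
  and from \<open>v\<close> to \<open>u\<close>; both get the same weight below, so a minimum over arcs is a minimum
  over edges.
\<close>

definition proper_coloring :: "('a, 'b) pre_digraph \<Rightarrow> nat \<Rightarrow> ('a \<Rightarrow> nat) \<Rightarrow> bool" where
  "proper_coloring G n c \<longleftrightarrow>
     c ` verts G \<subseteq> {1..n} \<and> (\<forall>e \<in> arcs G. c (tail G e) \<noteq> c (head G e))"

definition chromatic_number :: "('a, 'b) pre_digraph \<Rightarrow> nat" where
  "chromatic_number G = (LEAST n. \<exists>c. proper_coloring G n c)"

text \<open>Labelings are extensional, so that they correspond exactly to the maps
  from the vertex set to \<open>{1..k}\<close> and form a finite set.\<close>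

definition anti_labelings :: "nat \<Rightarrow> ('a, 'b) pre_digraph \<Rightarrow> ('a \<Rightarrow> nat) set" where
  "anti_labelings k G = verts G \<rightarrow>\<^sub>E {1..k}"

text \<open>Labels are converted to integers because subtraction on naturals truncates.\<close>

definition edge_weight :: "('a, 'b) pre_digraph \<Rightarrow> ('a \<Rightarrow> nat) \<Rightarrow> 'b \<Rightarrow> int" where
  "edge_weight G \<psi> e = \<bar>int (\<psi> (tail G e)) - int (\<psi> (head G e))\<bar>"

text \<open>Only meaningful if \<open>G\<close> has an edge, as \<open>Min {}\<close> is unspecified; chromatic number at
  least 2 guarantees this.\<close>

definition graph_weight :: "('a, 'b) pre_digraph \<Rightarrow> ('a \<Rightarrow> nat) \<Rightarrow> int" where
  "graph_weight G \<psi> = Min (edge_weight G \<psi> ` arcs G)"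

definition anti_labeling_number :: "nat \<Rightarrow> ('a, 'b) pre_digraph \<Rightarrow> int" where
  "anti_labeling_number k G = Max (graph_weight G ` anti_labelings k G)"

end

theory Submission
  imports Defs
begin

text \<open>
  Labelings with large edge weights and proper colorings with few colors are two views of the
  same thing. If every edge of a labeling with labels up to \<open>k\<close> has weight at least
  \<open>w \<ge> 1\<close>, then cutting \<open>{1..k}\<close> into consecutive blocks of length \<open>w\<close> separates
  adjacent vertices, since two labels in one block differ by less than \<open>w\<close>. The blocks are
  thus the colors of a proper coloring with \<open>(k - 1) div w + 1\<close> colors, which forces
  \<open>\<chi> - 1 \<le> (k - 1) div w\<close>, that is, \<open>w \<le> (k - 1) div (\<chi> - 1)\<close>
  (lemma \<open>proper_coloring_of_labeling\<close>).
  Conversely, spreading the colors of an optimal coloring over the labels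
  \<open>1, 1 + w, \<dots>, 1 + (\<chi> - 1) w\<close> makes all weights at least \<open>w\<close>, and for
  \<open>w = (k - 1) div (\<chi> - 1)\<close> these labels do not exceed \<open>k\<close>
  (lemma \<open>labeling_of_proper_coloring\<close>).
\<close>

text \<open>The lack of loops makes any injective coloring proper, so the minimum that defines the
  chromatic number is attained.\<close>

lemma ex_proper_coloring:
  assumes "graph G"
  shows "\<exists>n c. proper_coloring G n c"
proof -
  interpret graph G by fact
  obtain c :: "'a \<Rightarrow> nat" and n where
    c: "c ` verts G = {i. i < n}" "inj_on c (verts G)"
    using finite_imp_inj_to_nat_seg[OF finite_verts] by blast
  have "c (tail G e) \<noteq> c (head G e)" if "e \<in> arcs G" for e
    using c(2) that no_loops[OF that] by (auto dest: inj_onD)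
  moreover have "c v < n" if "v \<in> verts G" for v
    using c(1) that by auto
  ultimately have "proper_coloring G n (\<lambda>v. Suc (c v))"
    by (auto simp: proper_coloring_def Suc_le_eq)
  then show ?thesis by blast
qed

lemma chromatic_number_attained:
  assumes "graph G"
  obtains c where "proper_coloring G (chromatic_number G) c"
proof -
  have "\<exists>c. proper_coloring G (chromatic_number G) c"
    unfolding chromatic_number_def
    using ex_proper_coloring[OF assms] by (rule LeastI_ex)
  with that show ?thesis by blast
qed

lemma chromatic_number_le:
  "proper_coloring G n c \<Longrightarrow> chromatic_number G \<le> n"
  unfolding chromatic_number_def by (rule Least_le) blast

lemma arcs_nonempty_if_chromatic_number_ge_2:
  assumes "chromatic_number G \<ge> 2"
  shows "arcs G \<noteq> {}"
proof
  assume "arcs G = {}"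
  then have "proper_coloring G 1 (\<lambda>_. 1)"
    by (auto simp: proper_coloring_def)
  then show False
    using chromatic_number_le[of G 1] assms by fastforce
qed

lemma proper_coloring_of_labeling:
  assumes "wf_digraph G" "\<psi> \<in> anti_labelings k G" "w \<ge> 1"
    and weight: "\<forall>e\<in>arcs G. int w \<le> edge_weight G \<psi> e"
  shows "proper_coloring G ((k - 1) div w + 1) (\<lambda>v. (\<psi> v - 1) div w + 1)"
proof -
  interpret wf_digraph G by fact
  have range: "1 \<le> \<psi> v" "\<psi> v \<le> k" if "v \<in> verts G" for v
    using assms(2) that by (auto simp: anti_labelings_def)
  have "(\<psi> v - 1) div w \<le> (k - 1) div w" if "v \<in> verts G" for v
    using range[OF that] by (intro div_le_mono) simp
  moreover have "(\<psi> (tail G e) - 1) div w \<noteq> (\<psi> (head G e) - 1) div w"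
    if e: "e \<in> arcs G" for e
  proof
    let ?a = "\<psi> (tail G e) - 1" and ?b = "\<psi> (head G e) - 1"
    assume same_block: "?a div w = ?b div w"
    have "?a = ?a div w * w + ?a mod w" "?b = ?a div w * w + ?b mod w"
      by (simp, metis same_block div_mult_mod_eq)
    moreover have "?a mod w < w" "?b mod w < w"
      using assms(3) by simp_all
    ultimately have "\<bar>int ?a - int ?b\<bar> < int w"
      by linarith
    moreover have "\<bar>int ?a - int ?b\<bar> = edge_weight G \<psi> e"
      using range(1)[OF tail_in_verts[OF e]] range(1)[OF head_in_verts[OF e]]
      by (simp add: edge_weight_def of_nat_diff)
    ultimately show False
      using weight e by fastforce
  qed
  ultimately show ?thesis
    by (auto simp: proper_coloring_def)
qed

lemma labeling_of_proper_coloring: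
  assumes "wf_digraph G" "proper_coloring G n c" "(n - 1) * w + 1 \<le> k"
  defines "\<psi> \<equiv> restrict (\<lambda>v. (c v - 1) * w + 1) (verts G)"
  shows "\<psi> \<in> anti_labelings k G" "\<forall>e\<in>arcs G. int w \<le> edge_weight G \<psi> e"
proof -
  interpret wf_digraph G by fact
  have range: "1 \<le> c v" "c v \<le> n" if "v \<in> verts G" for v
    using assms(2) that by (auto simp: proper_coloring_def)
  have "(c v - 1) * w + 1 \<le> k" if "v \<in> verts G" for v
  proof -
    have "(c v - 1) * w \<le> (n - 1) * w"
      using range[OF that] by (intro mult_right_mono) auto
    then show ?thesis using assms(3) by linarith
  qed
  then show "\<psi> \<in> anti_labelings k G"
    by (auto simp: anti_labelings_def \<psi>_def)
  show "\<forall>e\<in>arcs G. int w \<le> edge_weight G \<psi> e"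
  proof
    fix e assume e: "e \<in> arcs G"
    note ends = tail_in_verts[OF e] head_in_verts[OF e]
    have "c (tail G e) \<noteq> c (head G e)"
      using assms(2) e by (auto simp: proper_coloring_def)
    then have "1 \<le> \<bar>int (c (tail G e)) - int (c (head G e))\<bar>"
      by linarith
    then have "1 * int w \<le> \<bar>int (c (tail G e)) - int (c (head G e))\<bar> * int w"
      by (intro mult_right_mono) auto
    also have "\<dots> = \<bar>(int (c (tail G e)) - int (c (head G e))) * int w\<bar>"
      by (simp add: abs_mult)
    also have "\<dots> = edge_weight G \<psi> e"
      using ends range(1)[OF ends(1)] range(1)[OF ends(2)]
      by (simp add: edge_weight_def \<psi>_def of_nat_diff algebra_simps)
    finally show "int w \<le> edge_weight G \<psi> e" by simp
  qed
qed

theorem theorem3: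
  fixes G :: "('a, 'b) pre_digraph" and k :: nat
  assumes "graph G"
    and "chromatic_number G \<ge> 2"
    and "k \<ge> 1"
  shows "anti_labeling_number k G =
           \<lfloor>(real k - 1) / (real (chromatic_number G) - 1)\<rfloor>"
proof -
  interpret graph G by fact
  let ?\<chi> = "chromatic_number G"
  define m where "m = (k - 1) div (?\<chi> - 1)"
  have weight_ge_iff: "w \<le> graph_weight G \<psi> \<longleftrightarrow> (\<forall>e\<in>arcs G. w \<le> edge_weight G \<psi> e)" for w \<psi>
    using arcs_nonempty_if_chromatic_number_ge_2[OF assms(2)]
    by (simp add: graph_weight_def Min_ge_iff)
  have upper: "graph_weight G \<psi> \<le> int m" if \<psi>: "\<psi> \<in> anti_labelings k G" for \<psi>
  proof (cases "graph_weight G \<psi> \<le> 0")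
    case False
    define w where "w = nat (graph_weight G \<psi>)"
    have w: "w \<ge> 1" "graph_weight G \<psi> = int w"
      using False by (auto simp: w_def)
    then have "\<forall>e\<in>arcs G. int w \<le> edge_weight G \<psi> e"
      using weight_ge_iff[of "int w" \<psi>] by simp
    then have "?\<chi> \<le> (k - 1) div w + 1"
      using proper_coloring_of_labeling[OF wf_digraph_axioms \<psi> w(1)] chromatic_number_le
      by blast
    then have "?\<chi> - 1 \<le> (k - 1) div w"
      by linarith
    then have "(?\<chi> - 1) * w \<le> k - 1"
      using w(1) less_eq_div_iff_mult_less_eq[of w "?\<chi> - 1" "k - 1"] by simp
    then have "w \<le> m"
      using assms(2) less_eq_div_iff_mult_less_eq[of "?\<chi> - 1" w "k - 1"]
      by (simp add: m_def mult.commute)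
    with w(2) show ?thesis by simp
  qed simp
  obtain c where c: "proper_coloring G ?\<chi> c"
    using chromatic_number_attained[OF assms(1)] .
  have "(?\<chi> - 1) * m + 1 \<le> k"
    using times_div_less_eq_dividend[of "?\<chi> - 1" "k - 1"] assms(3) unfolding m_def by linarith
  from labeling_of_proper_coloring[OF wf_digraph_axioms c this]
  obtain \<psi> where \<psi>: "\<psi> \<in> anti_labelings k G" "int m \<le> graph_weight G \<psi>"
    using weight_ge_iff by blast
  have "finite (anti_labelings k G)"
    by (simp add: anti_labelings_def finite_PiE)
  then have "anti_labeling_number k G = int m"
    unfolding anti_labeling_number_def
    using upper \<psi> by (intro Max_eqI) (auto intro!: image_eqI[of _ _ \<psi>] antisym)
  also have "int m = \<lfloor>real (k - 1) / real (?\<chi> - 1)\<rfloor>"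
    by (simp add: m_def floor_divide_of_nat_eq)
  also have "\<dots> = \<lfloor>(real k - 1) / (real ?\<chi> - 1)\<rfloor>"
    using assms(2,3) by (simp add: of_nat_diff)
  finally show ?thesis .
qed

end
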